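(* For all $k\geq2$, $$\mathcal{D}_{21\mbox{-}3\mbox{-}\ldots\mbox{-} k}(x)=\mathcal{D}_{2\mbox{-}1\mbox{-}3\mbox{-}\ldots\mbox{-} k}(x)=G_{k-1}(x)+xG_{k-2}(x).$$
   Context: A permutation $\pi$ is a Dumont permutation (of the first kind) if each even integer in $\pi$ is followed by a smaller integer, and each odd integer is either followed by a larger integer or is the last element of $\pi$. Generalized patterns: letters separated by dashes may be at any distance, adjacent letters (as $21$ in $21\mbox{-}3\mbox{-}\cdots\mbox{-}k$) must be adjacent in the permutation. For a pattern $\tau$, $\mathcal{D}_\tau(x)=\sum_{n\geq0}\mathcal{D}_\tau(n)x^n$ where $\mathcal{D}_\tau(n)$ is the number of Dumont permutations of length $n$ avoiding $1\mbox{-}3\mbox{-}2$ and $\tau$. For $r\geq2$ consider $Q_r(x)=1+\frac{x^2Q_{r-1}(x)}{1-x^2Q_{r-2}(x)}$; $G_r(x)$ is its solution with $Q_0=Q_1=1$. *)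

theory Defs
  imports
    "HOL-Combinatorics.Multiset_Permutations"
    "HOL-Computational_Algebra.Formal_Power_Series"
begin

(* Permutations of length n are one-line words, i.e. elements of permutations_of_set {1..n};
   list positions are counted from 0. *)

definition dumont :: "nat list \<Rightarrow> bool" where
  "dumont xs \<longleftrightarrow> (\<forall>i < length xs.
     (even (xs ! i) \<longrightarrow> Suc i < length xs \<and> xs ! Suc i < xs ! i) \<and>
     (odd (xs ! i) \<longrightarrow> Suc i = length xs \<or> (Suc i < length xs \<and> xs ! i < xs ! Suc i)))"

(* A generalized pattern is the list of its maximal dash-free blocks,
   e.g. 21-3-4 is [[2,1],[3],[4]] and 1-3-2 is [[1],[3],[2]]. *)

type_synonym gpattern = "nat list list"

definition same_block :: "gpattern \<Rightarrow> nat \<Rightarrow> bool" where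
  "same_block p j \<longleftrightarrow> (\<exists>us b vs. p = us @ b # vs \<and>
     length (concat us) \<le> j \<and> Suc j < length (concat us) + length b)"
  \<comment> \<open>the letters at positions j and j + 1 of the underlying word are not separated by a dash\<close>

definition gcontains :: "nat list \<Rightarrow> gpattern \<Rightarrow> bool" where
  "gcontains xs p \<longleftrightarrow> (\<exists>f :: nat \<Rightarrow> nat.
     strict_mono_on {..<length (concat p)} f \<and>
     (\<forall>i < length (concat p). f i < length xs) \<and>
     (\<forall>i < length (concat p). \<forall>j < length (concat p).
        xs ! f i < xs ! f j \<longleftrightarrow> concat p ! i < concat p ! j) \<and>
     (\<forall>j. same_block p j \<longrightarrow> f (Suc j) = Suc (f j)))"

definition gavoids :: "nat list \<Rightarrow> gpattern \<Rightarrow> bool" where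
  "gavoids xs p \<longleftrightarrow> \<not> gcontains xs p"

definition D_count :: "gpattern \<Rightarrow> nat \<Rightarrow> nat" where
  "D_count p n = card {xs \<in> permutations_of_set {1..n}.
     dumont xs \<and> gavoids xs [[1], [3], [2]] \<and> gavoids xs p}"

definition D_gf :: "gpattern \<Rightarrow> rat fps" where
  "D_gf p = Abs_fps (\<lambda>n. of_nat (D_count p n))"

(* The tail 3-...-k is empty for k = 2. *)

definition pat_21_3_k :: "nat \<Rightarrow> gpattern" where
  "pat_21_3_k k = [2, 1] # map (\<lambda>i. [i]) [3..<Suc k]"

definition pat_2_1_3_k :: "nat \<Rightarrow> gpattern" where
  "pat_2_1_3_k k = [2] # [1] # map (\<lambda>i. [i]) [3..<Suc k]"

(* The denominator has constant coefficient 1, so the division is by a unit. *)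

fun G :: "nat \<Rightarrow> rat fps" where
  "G 0 = 1"
| "G (Suc 0) = 1"
| "G (Suc (Suc r)) = 1 + fps_X\<^sup>2 * G (Suc r) / (1 - fps_X\<^sup>2 * G r)"

end

theory Submission
  imports Defs "HOL-Library.Sublist" "HOL-Computational_Algebra.Formal_Laurent_Series"
begin

text \<open>
  In a permutation avoiding 1-3-2 everything to the left of the maximum exceeds everything to its
  right. Together with the parity conditions this forces a Dumont permutation of odd length
  \<open>2n + 1\<close> to be \<open>A (2n + 1)\<close>, and one of length \<open>2n + 2\<close> to be either
  \<open>(2n + 2) A (2n + 1)\<close> or \<open>(A + 2b) (2n + 1) (2n + 2) B\<close>, where \<open>A\<close> and \<open>B\<close> are again
  of this kind, of even length, and \<open>B\<close> has length \<open>2b > 0\<close>. Appending a maximum lengthens the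
  longest pattern 2-1-3-...-k by one, so the series \<open>E\<^sub>k\<close> of even-length avoiders satisfies
  \<open>E\<^sub>k = 1 + x\<^sup>2 E\<^bsub>k-1\<^esub> + x\<^sup>2 E\<^bsub>k-2\<^esub> (E\<^sub>k - 1)\<close>, the recurrence of \<open>G\<^bsub>k-1\<^esub>\<close>,
  and the odd lengths contribute \<open>x E\<^bsub>k-1\<^esub>\<close>.
\<close>

section \<open>The Dumont condition under concatenation and shifting\<close>

definition dumont_step :: "nat \<Rightarrow> nat \<Rightarrow> bool" where
  "dumont_step x y \<longleftrightarrow> (if even x then y < x else x < y)"

text \<open>Trades positions for a relation between neighbours and a condition on the last letter,
  so that the rules for \<open>successively\<close> over \<open>@\<close> and \<open>#\<close> can
  split words.\<close>

lemma dumont_iff_successively: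
  "dumont xs \<longleftrightarrow> successively dumont_step xs \<and> (xs = [] \<or> odd (last xs))"
proof -
  have nth: "successively P ys \<longleftrightarrow> (\<forall>i. Suc i < length ys \<longrightarrow> P (ys ! i) (ys ! Suc i))"
    for P and ys :: "nat list"
    by (induction P ys rule: successively.induct)
       (auto simp: nth_Cons split: nat.splits)
  show ?thesis
  proof (cases "xs = []")
    case False
    then have l: "last xs = xs ! (length xs - 1)" by (rule last_conv_nth)
    show ?thesis
    proof
      assume d: "dumont xs"
      then have "odd (last xs)"
        unfolding dumont_def l using False
        by (metis One_nat_def Suc_pred diff_less less_irrefl length_greater_0_conv zero_less_one)
      with d show "successively dumont_step xs \<and> (xs = [] \<or> odd (last xs))"
        unfolding nth dumont_def dumont_step_def by (metis Suc_lessD less_irrefl)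
    next
      assume s: "successively dumont_step xs \<and> (xs = [] \<or> odd (last xs))"
      show "dumont xs"
        unfolding dumont_def
      proof (intro allI impI)
        fix i assume i: "i < length xs"
        show "(even (xs ! i) \<longrightarrow> Suc i < length xs \<and> xs ! Suc i < xs ! i) \<and>
          (odd (xs ! i) \<longrightarrow> Suc i = length xs \<or> (Suc i < length xs \<and> xs ! i < xs ! Suc i))"
        proof (cases "Suc i < length xs")
          case True
          then have "dumont_step (xs ! i) (xs ! Suc i)" using s by (simp add: nth)
          then show ?thesis using True by (auto simp: dumont_step_def split: if_splits)
        next
          case False
          then have "i = length xs - 1" "Suc i = length xs" using i by auto
          then show ?thesis using s l \<open>xs \<noteq> []\<close> by auto
        qed
      qed
    qed
  qed (simp add: dumont_def)
qed

lemma dumont_Nil [simp]: "dumont []"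
  by (simp add: dumont_def)

lemma dumont_snoc_max:
  assumes "odd n" "\<forall>a\<in>set A. a < n"
  shows "dumont (A @ [n]) \<longleftrightarrow> dumont A"
  using assms by (cases A rule: rev_cases)
    (auto simp: dumont_iff_successively successively_append_iff dumont_step_def)

text \<open>Stepping up to the maximum requires \<open>A\<close> to end in an odd letter, which
  \<open>A\<close> must do on its own as well; stepping down from it is what an even letter asks
  for. With \<open>B\<close> empty the word would end in an even letter.\<close>

lemma dumont_append_max:
  assumes "even n" "\<forall>a\<in>set A. a < n" "\<forall>b\<in>set B. b < n" "B \<noteq> []"
  shows "dumont (A @ n # B) \<longleftrightarrow> dumont A \<and> dumont B"
  using assms by (cases A rule: rev_cases; cases B)
    (auto simp: dumont_iff_successively successively_append_iff successively_Cons dumont_step_def)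

text \<open>The successor of an even letter witnesses this. It later forces the shift in the
  decomposition to be even.\<close>

lemma dumont_even_not_least:
  assumes "dumont A" "x \<in> set A" "even x"
  shows "\<exists>y\<in>set A. y < x"
  using assms unfolding dumont_def by (metis in_set_conv_nth)

text \<open>An odd letter that is not last has a larger successor, which a maximum cannot
  have.\<close>

lemma dumont_odd_max_last:
  assumes "dumont A" "x \<in> set A" "odd x" "\<forall>a\<in>set A. a \<le> x"
  shows "\<exists>A'. A = A' @ [x]"
proof -
  obtain i where i: "i < length A" "A ! i = x" using assms by (meson in_set_conv_nth)
  have "Suc i = length A"
    using assms i unfolding dumont_def by (metis leD nth_mem)
  then have "x = last A" using i by (metis diff_Suc_1 last_conv_nth length_0_conv nat.distinct(1))
  then show ?thesis using i by (metis append_butlast_last_id length_0_conv not_less0)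
qed

lemma dumont_shift:
  assumes "even c"
  shows "dumont (map ((+) c) A) \<longleftrightarrow> dumont A"
  using assms by (simp add: dumont_def cong: conj_cong)

section \<open>Avoidance of 1-3-2 around the maximum\<close>

text \<open>Recursive rather than positional, so that inductions over the prefix \<open>A\<close> of
  \<open>A @ n # B\<close> unfold it one letter at a time.\<close>

fun avoids132 :: "nat list \<Rightarrow> bool" where
  "avoids132 [] \<longleftrightarrow> True"
| "avoids132 (x # xs) \<longleftrightarrow> avoids132 xs \<and> sorted_wrt (\<lambda>b c. \<not> (x < c \<and> c < b)) xs"

lemma avoids132_iff_nth:
  "avoids132 xs \<longleftrightarrow>
     (\<forall>i j l. i < j \<and> j < l \<and> l < length xs \<longrightarrow> \<not> (xs ! i < xs ! l \<and> xs ! l < xs ! j))"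
  (is "_ \<longleftrightarrow> ?R xs")
proof (induction xs)
  case (Cons x xs)
  have "?R (x # xs) \<longleftrightarrow> ?R xs \<and>
    (\<forall>j l. j < l \<and> l < length xs \<longrightarrow> \<not> (x < xs ! l \<and> xs ! l < xs ! j))"
    (is "_ \<longleftrightarrow> ?R xs \<and> ?S")
  proof
    assume a: "?R (x # xs)"
    have "?R xs"
      using a by (metis Suc_less_eq length_Cons nth_Cons_Suc)
    moreover have ?S
      using a by (metis Suc_less_eq length_Cons nth_Cons_0 nth_Cons_Suc zero_less_Suc)
    ultimately show "?R xs \<and> ?S" ..
  next
    assume a: "?R xs \<and> ?S"
    show "?R (x # xs)"
    proof (intro allI impI)
      fix i j l assume h: "i < j \<and> j < l \<and> l < length (x # xs)"
      obtain j' l' where "j = Suc j'" "l = Suc l'"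
        using h by (metis gr0_implies_Suc less_nat_zero_code not_gr0)
      then show "\<not> ((x # xs) ! i < (x # xs) ! l \<and> (x # xs) ! l < (x # xs) ! j)"
        using a h by (cases i) auto
    qed
  qed
  then show ?case using Cons.IH by (auto simp: sorted_wrt_iff_nth_less)
qed simp

lemma avoids132_snoc_max:
  assumes "\<forall>a\<in>set A. a < n"
  shows "avoids132 (A @ [n]) \<longleftrightarrow> avoids132 A"
  using assms by (induction A) (auto simp: sorted_wrt_append)

text \<open>If \<open>a < b\<close> with \<open>a\<close> before and \<open>b\<close> after the
  maximum, then \<open>a\<close>, \<open>n\<close>, \<open>b\<close> is a 1-3-2. Conversely, an
  occurrence with its letter 1 in \<open>A\<close> cannot continue into \<open>B\<close>, whose
  letters are all smaller, and \<open>n\<close> cannot be its letter 2.\<close>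

lemma avoids132_append_max:
  assumes "\<forall>a\<in>set A. a < n" "\<forall>b\<in>set B. b < n" "set A \<inter> set B = {}"
  shows "avoids132 (A @ n # B) \<longleftrightarrow>
           avoids132 A \<and> avoids132 B \<and> (\<forall>a\<in>set A. \<forall>b\<in>set B. b < a)"
proof -
  have s: "sorted_wrt (\<lambda>b c. \<not> (x < c \<and> c < b)) B" if "\<forall>b\<in>set B. b < x" for x
    using that by (induction B) auto
  have n: "sorted_wrt (\<lambda>b c. \<not> (n < c \<and> c < b)) B" using s assms by blast
  show ?thesis
    using assms
  proof (induction A)
    case Nil
    then show ?case using n by auto
  next
    case (Cons x A)
    have "sorted_wrt (\<lambda>b c. \<not> (x < c \<and> c < b)) (A @ n # B) \<longleftrightarrow>
      sorted_wrt (\<lambda>b c. \<not> (x < c \<and> c < b)) A \<and> (\<forall>b\<in>set B. b < x)" (is "?L \<longleftrightarrow> ?R")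
    proof
      assume ?L
      \<comment> \<open>The pair \<open>n\<close>, \<open>b\<close> rules out \<open>x < b\<close>,
        and disjointness rules out \<open>x = b\<close>.\<close>
      then show ?R using Cons.prems by (auto simp: sorted_wrt_append) (metis linorder_neqE_nat)
    next
      assume ?R
      then show ?L using Cons.prems s by (auto simp: sorted_wrt_append)
    qed
    with Cons show ?case by auto
  qed
qed

lemma avoids132_shift: "avoids132 (map ((+) c) A) \<longleftrightarrow> avoids132 A"
  by (induction A) (auto simp: sorted_wrt_map)

section \<open>The pattern 2-1-3-...-k in concatenations\<close>

text \<open>\<open>contains213 j\<close> is containment of the pattern 2-1-3-...-\<open>(j + 2)\<close>.\<close>

definition contains213 :: "nat \<Rightarrow> nat list \<Rightarrow> bool" where
  "contains213 j xs \<longleftrightarrow> (\<exists>a b cs. subseq (a # b # cs) xs \<and> b < a \<and>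
     sorted_wrt (<) (a # cs) \<and> length cs = j)"

lemma subseq_set: "subseq xs ys \<Longrightarrow> x \<in> set xs \<Longrightarrow> x \<in> set ys"
  by (induction rule: list_emb.induct) auto

lemma subseq_snocD:
  assumes "subseq (us @ [c]) (A @ [n])"
  shows "subseq us A"
proof -
  obtain xs ys where 1: "us @ [c] = xs @ ys" "subseq xs A" "subseq ys [n]"
    using assms by (rule subseq_appendE)
  have "length ys \<le> 1" using 1(3) list_emb_length by fastforce
  then have "ys = [] \<or> ys = [c]" using 1(1) by (cases ys rule: rev_cases) auto
  then show ?thesis using 1
    by (metis append_Nil2 append1_eq_conv subseq_order.order_trans prefix_imp_subseq prefixI)
qed

lemma contains213_Nil [simp]: "\<not> contains213 j []"
  by (simp add: contains213_def)

text \<open>Dropping the last letter of an occurrence leaves one inside \<open>A\<close>, and the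
  maximum \<open>n\<close> extends the tail of any occurrence in \<open>A\<close>.\<close>

lemma contains213_snoc_max:
  assumes "\<forall>a\<in>set A. a < n"
  shows "contains213 (Suc j) (A @ [n]) \<longleftrightarrow> contains213 j A"
proof
  assume "contains213 (Suc j) (A @ [n])"
  then obtain a b cs where 1: "subseq (a # b # cs) (A @ [n])" "b < a" "sorted_wrt (<) (a # cs)"
    "length cs = Suc j" unfolding contains213_def by blast
  obtain ds d where cs: "cs = ds @ [d]" using 1(4) by (cases cs rule: rev_cases) auto
  have "subseq (a # b # ds) A"
    using subseq_snocD[of "a # b # ds" d A n] 1(1) cs by simp
  then show "contains213 j A" unfolding contains213_def
    using 1 cs by (intro exI[of _ a] exI[of _ b] exI[of _ ds]) (auto simp: sorted_wrt_append)
next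
  assume "contains213 j A"
  then obtain a b cs where 1: "subseq (a # b # cs) A" "b < a" "sorted_wrt (<) (a # cs)"
    "length cs = j" unfolding contains213_def by blast
  have "subseq ((a # b # cs) @ [n]) (A @ [n])" using 1 by (simp del: append_Cons)
  moreover have "x < n" if "x \<in> set (a # cs)" for x
    using subseq_set[OF 1(1)] that assms by auto
  ultimately show "contains213 (Suc j) (A @ [n])" unfolding contains213_def
    using 1 by (intro exI[of _ a] exI[of _ b] exI[of _ "cs @ [n]"]) (auto simp: sorted_wrt_append)
qed

text \<open>The new final letter could only serve as the letter 1, but it is larger than everything
  before it.\<close>

lemma contains213_0_snoc_max:
  assumes "\<forall>a\<in>set A. a < n"
  shows "contains213 0 (A @ [n]) \<longleftrightarrow> contains213 0 A"
proof
  assume "contains213 0 (A @ [n])"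
  then obtain a b where 1: "subseq ([a] @ [b]) (A @ [n])" "b < a" unfolding contains213_def by auto
  have "a \<in> set A" using subseq_snocD[OF 1(1)] subseq_singleton_left by fast
  with 1(2) assms have "b \<noteq> n" by auto
  obtain xs ys where 2: "[a,b] = xs @ ys" "subseq xs A" "subseq ys [n]"
    using 1(1) by (auto elim: subseq_appendE)
  have "ys = []"
  proof (cases ys rule: rev_cases)
    case (snoc zs z)
    with 2 have "z = b"
      by (metis append_assoc append_eq_Cons_conv last.simps last_snoc list.simps(3) snoc_eq_iff_butlast)
    with snoc 2(3) have "b \<in> set [n]" using subseq_set[of ys "[n]" b] by simp
    then show ?thesis using \<open>b \<noteq> n\<close> by simp
  qed
  then show "contains213 0 A" using 1 2 unfolding contains213_def by auto
next
  assume "contains213 0 A"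
  then show "contains213 0 (A @ [n])" unfolding contains213_def
    by (metis subseq_rev_drop_many)
qed

text \<open>A straddling occurrence would have its first letter in \<open>A\<close> and the last
  letter of its tail in \<open>B\<close>, so the latter would be the smaller one, against the
  pattern. A nonempty tail matters: a bare 2-1 can straddle.\<close>

lemma contains213_append:
  assumes "\<forall>a\<in>set A. \<forall>b\<in>set B. b < a"
  shows "contains213 (Suc j) (A @ B) \<longleftrightarrow> contains213 (Suc j) A \<or> contains213 (Suc j) B"
proof
  assume "contains213 (Suc j) (A @ B)"
  then obtain a b cs where 1: "subseq (a # b # cs) (A @ B)" "b < a" "sorted_wrt (<) (a # cs)"
    "length cs = Suc j" unfolding contains213_def by blast
  obtain xs ys where 2: "a # b # cs = xs @ ys" "subseq xs A" "subseq ys B"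
    using 1(1) by (rule subseq_appendE)
  have "xs = [] \<or> ys = []"
  proof (rule ccontr)
    assume n: "\<not> ?thesis"
    then have "a \<in> set xs" using 2(1) by (cases xs) auto
    moreover have "last ys = last cs"
      using n 1(4) arg_cong[OF 2(1), of last] by (auto split: if_splits)
    then have "last cs \<in> set ys" using n last_in_set[of ys] by simp
    ultimately have "last cs < a" 
      using assms subseq_set[OF 2(2)] subseq_set[OF 2(3)] by blast
    moreover have "last cs \<in> set cs" using 1(4) by (intro last_in_set) auto
    ultimately show False using 1(3) by auto
  qed
  then show "contains213 (Suc j) A \<or> contains213 (Suc j) B"
  proof
    assume "xs = []"
    with 1 2 have "contains213 (Suc j) B" unfolding contains213_def by auto
    then show ?thesis ..
  next
    assume "ys = []"
    with 1 2 have "contains213 (Suc j) A" unfolding contains213_def by auto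
    then show ?thesis ..
  qed
next
  assume "contains213 (Suc j) A \<or> contains213 (Suc j) B"
  then show "contains213 (Suc j) (A @ B)" unfolding contains213_def
    by (metis subseq_drop_many subseq_rev_drop_many)
qed

text \<open>A leading maximum could only be the letter 2, and a nonempty tail would have to rise
  above it.\<close>

lemma contains213_Cons_max:
  assumes "\<forall>b\<in>set B. b < n"
  shows "contains213 (Suc j) (n # B) \<longleftrightarrow> contains213 (Suc j) B"
proof -
  have "\<not> contains213 (Suc j) [n]"
    by (auto simp: contains213_def)
  then show ?thesis using contains213_append[of "[n]" B j] assms by auto
qed

lemma contains213_shift: "contains213 j (map ((+) c) A) \<longleftrightarrow> contains213 j A"
proof
  assume "contains213 j A"
  then obtain a b cs where 1: "subseq (a # b # cs) A" "b < a" "sorted_wrt (<) (a # cs)"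
    "length cs = j" unfolding contains213_def by blast
  show "contains213 j (map ((+) c) A)" unfolding contains213_def
    using 1 subseq_map[OF 1(1), of "(+) c"]
    by (intro exI[of _ "c + a"] exI[of _ "c + b"] exI[of _ "map ((+) c) cs"]) (auto simp: sorted_wrt_map)
next
  assume "contains213 j (map ((+) c) A)"
  then obtain a b cs where 1: "subseq (a # b # cs) (map ((+) c) A)" "b < a" "sorted_wrt (<) (a # cs)"
    "length cs = j" unfolding contains213_def by blast
  \<comment> \<open>Truncated subtraction does undo the shift, as all letters concerned are at least
    \<open>c\<close>.\<close>
  have 2: "subseq (map (\<lambda>x. x - c) (a # b # cs)) A"
    using subseq_map[OF 1(1), of "\<lambda>x. x - c"] by (simp add: comp_def)
  have 3: "x \<ge> c" if "x \<in> set (a # b # cs)" for x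
    using subseq_set[OF 1(1) that] by auto
  have "a - c < x - c" if "x \<in> set cs" for x using 1(3) 3[of a] that by (auto simp: diff_less_mono)
  moreover have "sorted_wrt (\<lambda>x y. x - c < y - c) cs"
    by (rule sorted_wrt_mono_rel[of _ "(<)"]) (use 1(3) 3 in \<open>auto simp: diff_less_mono\<close>)
  moreover have "b - c < a - c" using 3[of b] 1(2) by (auto simp: diff_less_mono)
  ultimately show "contains213 j A" unfolding contains213_def
    using 1 2
    by (intro exI[of _ "a - c"] exI[of _ "b - c"] exI[of _ "map (\<lambda>x. x - c) cs"])
       (auto simp: sorted_wrt_map)
qed

section \<open>Decomposition of 1-3-2-avoiding Dumont permutations at the maximum\<close>

definition dumont132 :: "nat \<Rightarrow> nat list set" where
  "dumont132 n = {xs. distinct xs \<and> set xs = {1..n} \<and> dumont xs \<and> avoids132 xs}"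

lemma dumont132_0: "dumont132 0 = {[]}"
  by (auto simp: dumont132_def)

lemma finite_dumont132: "finite (dumont132 n)"
proof -
  have "dumont132 n \<subseteq> permutations_of_set {1..n}"
    by (auto simp: dumont132_def permutations_of_set_def)
  then show ?thesis using finite_permutations_of_set[of "{1..n}"] finite_subset by blast
qed

lemma length_dumont132: "xs \<in> dumont132 n \<Longrightarrow> length xs = n"
  unfolding dumont132_def using distinct_card[of xs] by auto

lemma less_of_mem_dumont132: "xs \<in> dumont132 n \<Longrightarrow> n < m \<Longrightarrow> \<forall>x\<in>set xs. x < m"
  unfolding dumont132_def by auto

lemma dumont132_odd: "dumont132 (2 * n + 1) = (\<lambda>A. A @ [2 * n + 1]) ` dumont132 (2 * n)"
proof (intro equalityI subsetI)
  fix xs assume xs: "xs \<in> dumont132 (2 * n + 1)"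
  then obtain A where A: "xs = A @ [2 * n + 1]"
    using dumont_odd_max_last[of xs "2 * n + 1"] by (auto simp: dumont132_def)
  have s: "set A = {1..2 * n}"
  proof -
    have x: "distinct xs" "set xs = {1..2 * n + 1}" using xs by (simp_all add: dumont132_def)
    have "set A = set xs - {2 * n + 1}" using x(1) unfolding A by auto
    also have "\<dots> = {1..2 * n}" unfolding x(2) by auto
    finally show ?thesis .
  qed
  then have "A \<in> dumont132 (2 * n)"
    using xs unfolding A dumont132_def
    by (simp add: dumont_snoc_max avoids132_snoc_max)
  then show "xs \<in> (\<lambda>A. A @ [2 * n + 1]) ` dumont132 (2 * n)" using A by blast
next
  fix xs assume "xs \<in> (\<lambda>A. A @ [2 * n + 1]) ` dumont132 (2 * n)"
  then obtain A where A: "A \<in> dumont132 (2 * n)" and xs: "xs = A @ [2 * n + 1]" by blast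
  have "set xs = {1..2 * n + 1}"
    using A unfolding xs dumont132_def by (simp add: atLeastAtMostSuc_conv)
  then show "xs \<in> dumont132 (2 * n + 1)"
    using A unfolding xs dumont132_def by (simp add: dumont_snoc_max avoids132_snoc_max)
qed

text \<open>The parameter \<open>b\<close>, half the length of \<open>B\<close>, is kept in the
  triple because it determines the shift of \<open>A\<close>.\<close>

definition join132 :: "nat \<Rightarrow> nat \<times> nat list \<times> nat list \<Rightarrow> nat list" where
  "join132 n = (\<lambda>(b, A, B). (map ((+) (2 * b)) A @ [2 * n + 1]) @ (2 * n + 2) # B)"

lemma down_closed_eq_atLeastAtMost:
  fixes S :: "nat set"
  assumes "S \<subseteq> {1..m}" "\<And>x y. y \<in> S \<Longrightarrow> 1 \<le> x \<Longrightarrow> x \<le> y \<Longrightarrow> x \<in> S"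
  shows "\<exists>b\<le>m. S = {1..b}"
proof (cases "S = {}")
  case False
  have "finite S" using assms(1) finite_subset by blast
  with False have M: "Max S \<in> S" "\<forall>x\<in>S. x \<le> Max S" by auto
  then have "S = {1..Max S}" using assms by (auto intro: assms(2)[OF M(1)])
  moreover have "Max S \<le> m" using M(1) assms(1) by auto
  ultimately show ?thesis by blast
qed auto

text \<open>Avoiding 1-3-2 makes the letters after the maximum an initial segment
  \<open>{1..b}\<close>. It is either everything else, so that the word begins with its maximum, or
  it leaves a nonempty left block whose least and greatest letters are constrained by
  parity.\<close>

lemma dumont132_even:
  "dumont132 (2 * n + 2) = (#) (2 * n + 2) ` dumont132 (2 * n + 1) \<union>
     join132 n ` (SIGMA b:{1..n}. dumont132 (2 * (n - b)) \<times> dumont132 (2 * b))"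
  (is "_ = ?L \<union> ?R")
proof (intro equalityI subsetI)
  fix xs assume xs: "xs \<in> dumont132 (2 * n + 2)"
  then have sx: "set xs = {1..2 * n + 2}" and dx: "distinct xs" "dumont xs" "avoids132 xs"
    by (auto simp: dumont132_def)
  have "2 * n + 2 \<in> set xs" by (simp add: sx)
  then obtain A B where AB: "xs = A @ (2 * n + 2) # B" by (meson split_list)
  have "set A \<union> set B = set xs - {2 * n + 2}" using dx(1) unfolding AB by auto
  also have "\<dots> = {1..2 * n + 1}" unfolding sx by auto
  finally have un: "set A \<union> set B = {1..2 * n + 1}" .
  have disj: "set A \<inter> set B = {}" using dx(1) unfolding AB by auto
  have "\<forall>x\<in>set A \<union> set B. x < 2 * n + 2" unfolding un by auto
  then have lt: "\<forall>a\<in>set A. a < 2 * n + 2" "\<forall>b\<in>set B. b < 2 * n + 2" by blast+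
  have "B \<noteq> []" using dx(2) unfolding AB by (auto simp: dumont_iff_successively)
  have "even (2 * n + 2)" by simp
  from dumont_append_max[OF this lt \<open>B \<noteq> []\<close>] have d: "dumont A" "dumont B"
    using dx(2) unfolding AB by blast+
  have av: "avoids132 A" "avoids132 B" "\<forall>a\<in>set A. \<forall>b\<in>set B. b < a"
    using dx(3) avoids132_append_max[OF lt disj] unfolding AB by blast+
  \<comment> \<open>The letters of \<open>A\<close> exceed all of \<open>B\<close>, so nothing below
    a letter of \<open>B\<close> can lie in \<open>A\<close>.\<close>
  have "\<exists>b\<le>2 * n + 1. set B = {1..b}"
  proof (rule down_closed_eq_atLeastAtMost)
    show "set B \<subseteq> {1..2 * n + 1}" using un by blast
    fix x y assume h: "y \<in> set B" "1 \<le> x" "x \<le> y"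
    then have "y \<le> 2 * n + 1" using lt by fastforce
    then have "x \<in> set A \<union> set B" using un h by auto
    then show "x \<in> set B" using av(3) h by (meson UnE leD)
  qed
  then obtain b where b: "b \<le> 2 * n + 1" "set B = {1..b}" by blast
  have sA: "set A = {b + 1..2 * n + 1}"
  proof -
    have "set A = {1..2 * n + 1} - {1..b}" using un disj unfolding b(2) by blast
    also have "\<dots> = {b + 1..2 * n + 1}" by auto
    finally show ?thesis .
  qed
  have b1: "b \<ge> 1" using b(2) \<open>B \<noteq> []\<close> by (cases b) auto
  show "xs \<in> ?L \<union> ?R"
  proof (cases "b = 2 * n + 1")
    case True
    then have "A = []" using sA by simp
    then have "B \<in> dumont132 (2 * n + 1)" using dx(1) b(2) d(2) av(2) unfolding AB True by (simp add: dumont132_def)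
    then show ?thesis using AB \<open>A = []\<close> by simp
  next
    case False
    \<comment> \<open>Otherwise the least letter \<open>b + 1\<close> of \<open>A\<close> would be
      even and need a smaller successor inside \<open>A\<close>.\<close>
    have "even b"
    proof (rule ccontr)
      assume "odd b"
      then have "\<exists>y\<in>set A. y < b + 1"
        using dumont_even_not_least[OF d(1), of "b + 1"] False b(1) by (simp add: sA)
      then show False by (simp add: sA)
    qed
    then obtain c where c: "b = 2 * c" by blast
    have cn: "c \<in> {1..n}" using c b(1) b1 by auto
    \<comment> \<open>The largest letter of the left block is odd, hence stands at its end.\<close>
    obtain A' where A': "A = A' @ [2 * n + 1]"
      using dumont_odd_max_last[OF d(1), of "2 * n + 1"] False b(1) by (auto simp: sA)
    have sA': "set A' = {2 * c + 1..2 * n}"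
    proof -
      have "set A' = set A - {2 * n + 1}" using dx(1) unfolding AB A' by auto
      also have "\<dots> = {2 * c + 1..2 * n}" unfolding sA c by auto
      finally show ?thesis .
    qed
    define C where "C = map (\<lambda>x. x - 2 * c) A'"
    have AC: "A' = map ((+) (2 * c)) C"
      unfolding C_def map_map comp_def by (rule map_idI[symmetric]) (simp add: sA')
    have "set C = (\<lambda>x. x - 2 * c) ` {2 * c + 1..2 * n}" by (simp add: C_def sA')
    also have "\<dots> = {1..2 * (n - c)}"
    proof -
      have "x \<in> (\<lambda>x. x - 2 * c) ` {2 * c + 1..2 * n}" if "x \<in> {1..2 * (n - c)}" for x
        using that cn by (intro image_eqI[of _ _ "x + 2 * c"]) auto
      then show ?thesis by auto
    qed
    finally have sC: "set C = {1..2 * (n - c)}" .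
    have "dumont A'" "avoids132 A'"
      using d(1) av(1) unfolding A' by (simp_all add: dumont_snoc_max avoids132_snoc_max sA')
    moreover have "distinct C" using dx(1) unfolding AB A' AC by (simp add: distinct_map)
    ultimately have "C \<in> dumont132 (2 * (n - c))"
      using sC unfolding AC by (simp add: dumont132_def dumont_shift avoids132_shift)
    moreover have "B \<in> dumont132 (2 * c)" using dx(1) b(2) d(2) av(2) unfolding AB c by (simp add: dumont132_def)
    ultimately have "(c, C, B) \<in> (SIGMA b:{1..n}. dumont132 (2 * (n - b)) \<times> dumont132 (2 * b))"
      using cn by simp
    moreover have "xs = join132 n (c, C, B)" by (simp add: AB A' AC join132_def)
    ultimately show ?thesis by blast
  qed
next
  fix xs assume "xs \<in> ?L \<union> ?R"
  then show "xs \<in> dumont132 (2 * n + 2)"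
  proof
    assume "xs \<in> ?L"
    then obtain B where B: "B \<in> dumont132 (2 * n + 1)" "xs = [] @ (2 * n + 2) # B" by auto
    have lt: "\<forall>b\<in>set B. b < 2 * n + 2" using B(1) by (rule less_of_mem_dumont132) simp
    have ne: "B \<noteq> []" using length_dumont132[OF B(1)] by auto
    have "set xs = {1..2 * n + 2}"
      using B(1) unfolding B(2) dumont132_def by (simp add: atLeastAtMostSuc_conv)
    moreover have "distinct xs" using B(1) lt unfolding B(2) dumont132_def by auto
    moreover have "dumont xs" "avoids132 xs"
      using B(1) lt ne dumont_append_max[of "2 * n + 2" "[]" B] avoids132_append_max[of "[]" "2 * n + 2" B]
      unfolding B(2) dumont132_def by simp_all
    ultimately show ?thesis by (simp add: dumont132_def)
  next
    assume "xs \<in> ?R"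
    then obtain b C B where b: "b \<in> {1..n}" and C: "C \<in> dumont132 (2 * (n - b))"
      and B: "B \<in> dumont132 (2 * b)" and x: "xs = join132 n (b, C, B)" by blast
    define A' where "A' = map ((+) (2 * b)) C"
    have sC: "set C = {1..2 * (n - b)}" using C by (simp add: dumont132_def)
    have sA': "set A' = {2 * b + 1..2 * n}"
    proof -
      have "x \<in> (+) (2 * b) ` {1..2 * (n - b)}" if "x \<in> {2 * b + 1..2 * n}" for x
        using that b by (intro image_eqI[of _ _ "x - 2 * b"]) auto
      then show ?thesis unfolding A'_def set_map sC using b by auto
    qed
    have A': "dumont A'" "avoids132 A'" "distinct A'"
      using C unfolding A'_def by (simp_all add: dumont132_def dumont_shift avoids132_shift distinct_map)
    define A where "A = A' @ [2 * n + 1]"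
    have sA: "set A = {2 * b + 1..2 * n + 1}" unfolding A_def using b by (auto simp: sA')
    have A: "dumont A" "avoids132 A" "distinct A"
      using A' by (simp_all add: A_def dumont_snoc_max avoids132_snoc_max sA')
    have xs: "xs = A @ (2 * n + 2) # B" by (simp add: x join132_def A_def A'_def)
    have B': "dumont B" "avoids132 B" "distinct B" "set B = {1..2 * b}" using B by (simp_all add: dumont132_def)
    have lt: "\<forall>a\<in>set A. a < 2 * n + 2" "\<forall>b\<in>set B. b < 2 * n + 2" "set A \<inter> set B = {}"
      "\<forall>a\<in>set A. \<forall>b\<in>set B. b < a"
      using b by (auto simp: sA B'(4))
    have ne: "B \<noteq> []" using length_dumont132[OF B] b by auto
    have "dumont xs" unfolding xs using A B' lt ne dumont_append_max[of "2 * n + 2" A B] by auto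
    moreover have "avoids132 xs" unfolding xs using A B' lt avoids132_append_max[of A "2 * n + 2" B] by auto
    moreover have "distinct xs" unfolding xs using A B' lt by auto
    moreover have "set xs = {1..2 * n + 2}" unfolding xs using b by (auto simp: sA B'(4))
    ultimately show ?thesis by (simp add: dumont132_def)
  qed
qed

section \<open>Counting the avoiders by length\<close>

definition avoiders :: "nat \<Rightarrow> nat \<Rightarrow> nat list set" where
  "avoiders j n = {xs \<in> dumont132 n. \<not> contains213 j xs}"

lemma finite_avoiders: "finite (avoiders j n)"
  using finite_dumont132 by (simp add: avoiders_def)

lemma avoiders_length_0: "avoiders j 0 = {[]}"
  by (auto simp: avoiders_def dumont132_0)

text \<open>The even maximum cannot be last, so it starts a descent, which is an occurrence of
  2-1.\<close>

lemma avoiders_0: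
  assumes "n > 0"
  shows "avoiders 0 (2 * n) = {}"
proof -
  have "contains213 0 xs" if xs: "xs \<in> dumont132 (2 * n)" for xs
  proof -
    have h: "distinct xs" "set xs = {1..2 * n}" "dumont xs" using xs by (auto simp: dumont132_def)
    have "2 * n \<in> set xs" using assms by (simp add: h(2))
    then obtain A B where AB: "xs = A @ (2 * n) # B" by (meson split_list)
    have "B \<noteq> []" using h(3) unfolding AB by (auto simp: dumont_iff_successively)
    then obtain b B' where B: "B = b # B'" by (cases B) auto
    have "b \<in> set xs" "b \<noteq> 2 * n" using h(1) unfolding AB B by auto
    then have "b < 2 * n" using h(2) by auto
    moreover have "subseq [2 * n, b] xs" unfolding AB B by (intro subseq_drop_many) simp
    ultimately show ?thesis unfolding contains213_def
      by (intro exI[of _ "2 * n"] exI[of _ b] exI[of _ "[]"]) simp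
  qed
  then show ?thesis by (auto simp: avoiders_def)
qed

text \<open>The truncated \<open>j - 1\<close> is intended: an appended maximum does not create a first
  descent, which is also why \<open>G 0 = G 1\<close>.\<close>

lemma card_avoiders_odd: "card (avoiders j (2 * n + 1)) = card (avoiders (j - 1) (2 * n))"
proof -
  have "contains213 j (A @ [2 * n + 1]) \<longleftrightarrow> contains213 (j - 1) A" if "A \<in> dumont132 (2 * n)" for A
    using less_of_mem_dumont132[OF that, of "2 * n + 1"]
    by (cases j) (simp_all add: contains213_snoc_max contains213_0_snoc_max)
  then have "avoiders j (2 * n + 1) = (\<lambda>A. A @ [2 * n + 1]) ` avoiders (j - 1) (2 * n)"
    unfolding avoiders_def dumont132_odd by auto
  then show ?thesis by (simp add: card_image inj_on_def)
qed

text \<open>Everything up to the maximum lies above \<open>B\<close>, so no occurrence straddles. In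
  the left part, peeling off \<open>2 * n + 2\<close> shortens the tail by one, and peeling off
  \<open>2 * n + 1\<close> shortens it once more unless it is already empty, whence
  \<open>j - 1\<close>.\<close>

lemma contains213_join132:
  assumes "b \<in> {1..n}" "A \<in> dumont132 (2 * (n - b))" "B \<in> dumont132 (2 * b)"
  shows "contains213 (Suc j) (join132 n (b, A, B)) \<longleftrightarrow>
           contains213 (j - 1) A \<or> contains213 (Suc j) B"
proof -
  let ?A = "map ((+) (2 * b)) A"
  have sA: "set A = {1..2 * (n - b)}" and sB: "set B = {1..2 * b}"
    using assms by (simp_all add: dumont132_def)
  have lt1: "\<forall>a\<in>set ?A. a < 2 * n + 1" using assms(1) by (auto simp: sA)
  have lt2: "\<forall>a\<in>set (?A @ [2 * n + 1]). a < 2 * n + 2" using lt1 by auto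
  have lt3: "\<forall>a\<in>set ((?A @ [2 * n + 1]) @ [2 * n + 2]). \<forall>b\<in>set B. b < a"
    using assms(1) by (auto simp: sA sB)
  have "join132 n (b, A, B) = ((?A @ [2 * n + 1]) @ [2 * n + 2]) @ B"
    by (simp add: join132_def)
  then have "contains213 (Suc j) (join132 n (b, A, B)) \<longleftrightarrow>
      contains213 j (?A @ [2 * n + 1]) \<or> contains213 (Suc j) B"
    by (simp only: contains213_append[OF lt3] contains213_snoc_max[OF lt2])
  also have "contains213 j (?A @ [2 * n + 1]) \<longleftrightarrow> contains213 (j - 1) ?A"
    by (cases j)
       (simp_all only: contains213_snoc_max[OF lt1] contains213_0_snoc_max[OF lt1] diff_Suc_1 diff_0_eq_0)
  finally show ?thesis by (simp only: contains213_shift)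
qed

text \<open>The leading maximum takes part in no occurrence with a nonempty tail, so only the final
  letter counts.\<close>

lemma contains213_Cons_snoc:
  assumes "A \<in> dumont132 (2 * n)"
  shows "contains213 (Suc j) ((2 * n + 2) # A @ [2 * n + 1]) \<longleftrightarrow> contains213 j A"
proof -
  have lt: "\<forall>a\<in>set A. a < 2 * n + 1" using assms by (rule less_of_mem_dumont132) simp
  then have "\<forall>a\<in>set (A @ [2 * n + 1]). a < 2 * n + 2" by auto
  from contains213_Cons_max[OF this] contains213_snoc_max[OF lt] show ?thesis by simp
qed

text \<open>\<open>B\<close> can be read off as what follows the unique maximum; its length gives
  \<open>b\<close>, and with it the shift to undo on the left.\<close>

lemma inj_on_join132:
  "inj_on (join132 n) (SIGMA b:{1..n}. dumont132 (2 * (n - b)) \<times> dumont132 (2 * b))"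
  (is "inj_on _ ?S")
proof (rule inj_onI)
  fix p q assume p: "p \<in> ?S" and q: "q \<in> ?S" and pq: "join132 n p = join132 n q"
  obtain b A B where p': "p = (b, A, B)" by (rule prod_cases3)
  obtain b' A' B' where q': "q = (b', A', B')" by (rule prod_cases3)
  have b: "b \<in> {1..n}"
    and A: "A \<in> dumont132 (2 * (n - b))"
    and B: "B \<in> dumont132 (2 * b)" "B' \<in> dumont132 (2 * b')"
    and eq: "join132 n (b, A, B) = join132 n (b', A', B')"
    using p q pq unfolding p' q' by simp_all
  have s: "set A = {1..2 * (n - b)}" "set B = {1..2 * b}"
    using A B(1) by (simp_all add: dumont132_def)
  have nA: "2 * n + 2 \<notin> set (map ((+) (2 * b)) A @ [2 * n + 1])"
    using b by (auto simp: s(1))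
  have nB: "2 * n + 2 \<notin> set B" using b by (simp add: s(2))
  have e: "map ((+) (2 * b)) A @ [2 * n + 1] = map ((+) (2 * b')) A' @ [2 * n + 1]" "B = B'"
    using eq unfolding join132_def prod.case append_Cons_eq_iff[OF nA nB] by blast+
  from e(2) have "b = b'" using length_dumont132[OF B(1)] length_dumont132[OF B(2)] by simp
  with e show "p = q" by (simp add: p' q' inj_map_eq_map)
qed

text \<open>Counts the two shapes of \<open>dumont132_even\<close>, with the odd-length word in the
  first one expanded by \<open>dumont132_odd\<close>. They are disjoint because only the first
  begins with the maximum.\<close>

lemma card_avoiders_even:
  "card (avoiders (Suc j) (2 * Suc n)) = card (avoiders j (2 * n)) +
     (\<Sum>b = 1..n. card (avoiders (j - 1) (2 * (n - b))) * card (avoiders (Suc j) (2 * b)))"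
proof -
  let ?f = "\<lambda>A. (2 * n + 2) # A @ [2 * n + 1]"
  let ?L = "?f ` avoiders j (2 * n)"
  let ?S = "SIGMA b:{1..n}. avoiders (j - 1) (2 * (n - b)) \<times> avoiders (Suc j) (2 * b)"
  have two: "2 * Suc n = 2 * n + 2" by simp
  have "dumont132 (2 * Suc n) = ?f ` dumont132 (2 * n) \<union>
      join132 n ` (SIGMA b:{1..n}. dumont132 (2 * (n - b)) \<times> dumont132 (2 * b))"
    using dumont132_even[of n] unfolding dumont132_odd image_image two .
  moreover have "{xs \<in> X \<union> Y. P xs} = {xs \<in> X. P xs} \<union> {xs \<in> Y. P xs}"
    for X Y :: "nat list set" and P by blast
  ultimately have "avoiders (Suc j) (2 * Suc n) = {xs \<in> ?f ` dumont132 (2 * n). \<not> contains213 (Suc j) xs} \<union>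
      {xs \<in> join132 n ` (SIGMA b:{1..n}. dumont132 (2 * (n - b)) \<times> dumont132 (2 * b)).
         \<not> contains213 (Suc j) xs}"
    by (simp only: avoiders_def)
  also have "{xs \<in> ?f ` dumont132 (2 * n). \<not> contains213 (Suc j) xs} = ?L"
    unfolding avoiders_def using contains213_Cons_snoc by blast
  also have "{xs \<in> join132 n ` (SIGMA b:{1..n}. dumont132 (2 * (n - b)) \<times> dumont132 (2 * b)).
      \<not> contains213 (Suc j) xs} = join132 n ` ?S"
  proof (intro equalityI subsetI)
    fix xs
    assume "xs \<in> {xs \<in> join132 n ` (SIGMA b:{1..n}. dumont132 (2 * (n - b)) \<times> dumont132 (2 * b)).
      \<not> contains213 (Suc j) xs}"
    then obtain b A B where h: "b \<in> {1..n}" "A \<in> dumont132 (2 * (n - b))" "B \<in> dumont132 (2 * b)"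
      "xs = join132 n (b, A, B)" "\<not> contains213 (Suc j) xs" by blast
    then have "(b, A, B) \<in> ?S" using contains213_join132[OF h(1-3), of j] by (simp add: avoiders_def)
    then show "xs \<in> join132 n ` ?S" using h(4) by blast
  next
    fix xs assume "xs \<in> join132 n ` ?S"
    then obtain b A B where h: "b \<in> {1..n}" "A \<in> avoiders (j - 1) (2 * (n - b))"
      "B \<in> avoiders (Suc j) (2 * b)" "xs = join132 n (b, A, B)" by blast
    have h': "A \<in> dumont132 (2 * (n - b))" "B \<in> dumont132 (2 * b)"
      using h(2,3) by (simp_all add: avoiders_def)
    have "(b, A, B) \<in> (SIGMA b:{1..n}. dumont132 (2 * (n - b)) \<times> dumont132 (2 * b))"
      using h(1) h' by simp
    moreover have "\<not> contains213 (Suc j) xs"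
      using contains213_join132[OF h(1) h', of j] h(2-4) by (simp add: avoiders_def)
    ultimately show "xs \<in> {xs \<in> join132 n ` (SIGMA b:{1..n}. dumont132 (2 * (n - b)) \<times> dumont132 (2 * b)).
      \<not> contains213 (Suc j) xs}" using h(4) by blast
  qed
  finally have eq: "avoiders (Suc j) (2 * Suc n) = ?L \<union> join132 n ` ?S" .
  have "?L \<inter> join132 n ` ?S = {}"
  proof -
    have "hd xs = 2 * n + 2" if "xs \<in> ?L" for xs using that by auto
    \<comment> \<open>The left block contains \<open>2 * n + 1\<close>, so it is nonempty and
      supplies the first letter, which is below the maximum.\<close>
    moreover have "hd xs \<noteq> 2 * n + 2" if "xs \<in> join132 n ` ?S" for xs
    proof -
      from that obtain b A B where h: "b \<in> {1..n}" "A \<in> avoiders (j - 1) (2 * (n - b))"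
        "xs = join132 n (b, A, B)" by blast
      have "hd (map ((+) (2 * b)) A @ [2 * n + 1]) \<in> set (map ((+) (2 * b)) A @ [2 * n + 1])"
        by (rule hd_in_set) simp
      then have "hd (map ((+) (2 * b)) A @ [2 * n + 1]) < 2 * n + 2"
        using h(1,2) by (auto simp: avoiders_def dumont132_def)
      then show ?thesis unfolding h(3) join132_def prod.case by (auto simp: hd_append split: if_splits)
    qed
    ultimately show ?thesis by blast
  qed
  moreover have "finite ?S" "finite ?L" by (auto intro!: finite_SigmaI simp: finite_avoiders)
  moreover have "inj_on (join132 n) ?S"
    by (rule inj_on_subset[OF inj_on_join132]) (auto simp: avoiders_def)
  moreover have "card ?L = card (avoiders j (2 * n))" by (rule card_image) (simp add: inj_on_def)
  moreover have "card ?S =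
      (\<Sum>b = 1..n. card (avoiders (j - 1) (2 * (n - b))) * card (avoiders (Suc j) (2 * b)))"
    by (subst card_SigmaI) (auto simp: finite_avoiders card_cartesian_product)
  ultimately show ?thesis
    unfolding eq by (simp add: card_Un_disjoint card_image)
qed

section \<open>Generating functions\<close>

text \<open>Indexed by half the length: substituting \<open>fps_X\<^sup>2\<close> yields the series
  \<open>E\<^sub>k\<close> of the overview for \<open>k = j + 2\<close>.\<close>

definition avoiders_gf :: "nat \<Rightarrow> rat fps" where
  "avoiders_gf j = Abs_fps (\<lambda>n. of_nat (card (avoiders j (2 * n))))"

lemma avoiders_gf_0: "avoiders_gf 0 = 1"
proof (rule fps_ext)
  fix n show "avoiders_gf 0 $ n = 1 $ n"
    using avoiders_0[of n] by (cases n) (simp_all add: avoiders_gf_def avoiders_length_0)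
qed

text \<open>Reads \<open>card_avoiders_even\<close> as a Cauchy product. The leading 1 is the empty
  word, and the subtracted 1 reflects that \<open>B\<close> is nonempty.\<close>

lemma avoiders_gf_Suc:
  "avoiders_gf (Suc j) = 1 + fps_X * avoiders_gf j +
     fps_X * (avoiders_gf (j - 1) * (avoiders_gf (Suc j) - 1))"
proof (rule fps_ext)
  fix n
  show "avoiders_gf (Suc j) $ n = (1 + fps_X * avoiders_gf j +
     fps_X * (avoiders_gf (j - 1) * (avoiders_gf (Suc j) - 1))) $ n"
  proof (cases n)
    case 0
    then show ?thesis by (simp add: avoiders_gf_def avoiders_length_0)
  next
    case (Suc m)
    let ?g = "\<lambda>b. avoiders_gf (j - 1) $ (m - b) * (avoiders_gf (Suc j) - 1) $ b"
    have "(avoiders_gf (j - 1) * (avoiders_gf (Suc j) - 1)) $ m = (\<Sum>b = 0..m. ?g b)"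
      by (subst mult.commute, simp add: fps_mult_nth mult.commute)
    \<comment> \<open>The summand at 0 vanishes because \<open>avoiders_gf (Suc j)\<close> has
      constant coefficient 1.\<close>
    also have "\<dots> = (\<Sum>b = 1..m. ?g b)"
      by (simp add: sum.atLeast_Suc_atMost avoiders_gf_def avoiders_length_0)
    also have "\<dots> = (\<Sum>b = 1..m. avoiders_gf (j - 1) $ (m - b) * avoiders_gf (Suc j) $ b)"
      by (rule sum.cong) auto
    finally show ?thesis
      using card_avoiders_even[of j m] by (simp add: Suc avoiders_gf_def)
  qed
qed

text \<open>The recurrence is linear in the series for \<open>Suc j\<close>, so it can be solved for
  that series by one division.\<close>

lemma compose_X2_avoiders_gf_Suc:
  "avoiders_gf (Suc j) oo fps_X\<^sup>2 =
     1 + fps_X\<^sup>2 * (avoiders_gf j oo fps_X\<^sup>2) /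
           (1 - fps_X\<^sup>2 * (avoiders_gf (j - 1) oo fps_X\<^sup>2))"
proof -
  let ?c = "\<lambda>f :: rat fps. f oo fps_X\<^sup>2"
  let ?d = "1 - fps_X\<^sup>2 * ?c (avoiders_gf (j - 1))"
  have "?c (avoiders_gf (Suc j)) = 1 + fps_X\<^sup>2 * ?c (avoiders_gf j) +
      fps_X\<^sup>2 * (?c (avoiders_gf (j - 1)) * (?c (avoiders_gf (Suc j)) - 1))"
    by (subst avoiders_gf_Suc)
       (simp add: fps_compose_add_distrib fps_compose_mult_distrib fps_compose_sub_distrib)
  then have "(?c (avoiders_gf (Suc j)) - 1) * ?d = fps_X\<^sup>2 * ?c (avoiders_gf j)"
    by (simp add: algebra_simps)
  \<comment> \<open>The constant coefficient shows the denominator to be nonzero, so the division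
    cancels the product.\<close>
  moreover have "?d $ 0 = 1" by simp
  then have "?d \<noteq> 0" by (metis fps_zero_nth zero_neq_one)
  ultimately have "fps_X\<^sup>2 * ?c (avoiders_gf j) / ?d = ?c (avoiders_gf (Suc j)) - 1"
    by (metis nonzero_mult_div_cancel_right)
  then show ?thesis by simp
qed

text \<open>The truncated index sends both initial values to \<open>avoiders_gf 0\<close>; a step of
  \<open>G\<close> is the solved recurrence at \<open>j = r\<close>.\<close>

lemma G_eq_compose: "G j = avoiders_gf (j - 1) oo fps_X\<^sup>2"
  by (induction j rule: G.induct) (simp_all add: avoiders_gf_0 compose_X2_avoiders_gf_Suc)

lemma G_nth: "G j $ n = (if even n then of_nat (card (avoiders (j - 1) n)) else 0)"
  by (auto simp: G_eq_compose fps_nth_compose_X_power avoiders_gf_def)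

text \<open>\<open>G (Suc j)\<close> supplies the even lengths. By \<open>card_avoiders_odd\<close>
  the count at \<open>2 * m + 1\<close> is the coefficient of \<open>G j\<close> at
  \<open>2 * m\<close>, which the factor \<open>fps_X\<close> moves up by one.\<close>

lemma avoiders_gf_total:
  "Abs_fps (\<lambda>n. of_nat (card (avoiders j n))) = G (Suc j) + fps_X * G j"
proof (rule fps_ext)
  fix n
  show "Abs_fps (\<lambda>n. of_nat (card (avoiders j n))) $ n = (G (Suc j) + fps_X * G j) $ n"
  proof (cases "even n")
    case True
    then show ?thesis by (cases n) (auto simp: G_nth)
  next
    case False
    then obtain m where "n = 2 * m + 1" by (metis oddE)
    then show ?thesis using card_avoiders_odd[of j m] by (simp add: G_nth)
  qed
qed

section \<open>Generalized patterns as subsequences\<close>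

text \<open>Links the position maps of \<open>gcontains\<close> to the subsequences of
  \<open>contains213\<close>.\<close>

lemma subseq_iff_strict_mono:
  "subseq ys xs \<longleftrightarrow> (\<exists>f :: nat \<Rightarrow> nat. strict_mono_on {..<length ys} f \<and>
     (\<forall>i < length ys. f i < length xs \<and> ys ! i = xs ! f i))" (is "_ \<longleftrightarrow> (\<exists>f. ?P ys xs f)")
proof
  assume "subseq ys xs"
  then show "\<exists>f. ?P ys xs f"
  proof (induction rule: list_emb.induct)
    case (list_emb_Nil xs)
    then show ?case by (auto simp: strict_mono_on_def)
  next
    case (list_emb_Cons ys xs x)
    then obtain f where "?P ys xs f" by blast
    then have "?P ys (x # xs) (\<lambda>i. Suc (f i))" by (auto simp: strict_mono_on_def)
    then show ?case by blast
  next
    case (list_emb_Cons2 y x ys xs)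
    then obtain f where "?P ys xs f" by blast
    with list_emb_Cons2 have "?P (y # ys) (x # xs) (case_nat 0 (\<lambda>i. Suc (f i)))"
      by (auto simp: strict_mono_on_def nth_Cons split: nat.splits)
    then show ?case by blast
  qed
next
  assume "\<exists>f. ?P ys xs f"
  then obtain f where f: "strict_mono_on {..<length ys} f"
    "\<And>i. i < length ys \<Longrightarrow> f i < length xs" "\<And>i. i < length ys \<Longrightarrow> ys ! i = xs ! f i" by blast
  \<comment> \<open>The chosen positions increase, so they form a subsequence of the list of all
    positions; mapping both lists by \<open>(!) xs\<close> gives the words.\<close>
  let ?js = "map f [0..<length ys]"
  have "sorted_wrt (<) ?js"
    using f(1) by (auto simp: strict_mono_on_def sorted_wrt_iff_nth_less)
  then have "subseq ?js [0..<length xs]"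
    using f(2) by (intro sorted_subset_imp_subseq) auto
  then have "subseq (map ((!) xs) ?js) (map ((!) xs) [0..<length xs])" by (rule subseq_map)
  moreover have "map ((!) xs) ?js = ys" using f(3) by (auto intro: nth_equalityI)
  ultimately show "subseq ys xs" by (simp add: map_nth)
qed

lemma concat_pat [simp]:
  "concat (pat_21_3_k k) = 2 # 1 # [3..<Suc k]" "concat (pat_2_1_3_k k) = 2 # 1 # [3..<Suc k]"
proof -
  have "concat (map (\<lambda>i. [i]) xs) = xs" for xs :: "nat list" by (induction xs) auto
  then show "concat (pat_21_3_k k) = 2 # 1 # [3..<Suc k]" "concat (pat_2_1_3_k k) = 2 # 1 # [3..<Suc k]"
    by (simp_all add: pat_21_3_k_def pat_2_1_3_k_def)
qed

lemma not_same_block_singletons: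
  assumes "\<forall>b\<in>set p. length b \<le> 1"
  shows "\<not> same_block p j"
  using assms by (fastforce simp: same_block_def)

text \<open>Only the first block has two letters, and they occupy positions 0 and 1.\<close>

lemma same_block_pat_21_3_k: "same_block (pat_21_3_k k) j \<longleftrightarrow> j = 0"
proof
  assume "same_block (pat_21_3_k k) j"
  then obtain us b vs where h: "pat_21_3_k k = us @ b # vs" "length (concat us) \<le> j"
    "Suc j < length (concat us) + length b" unfolding same_block_def by blast
  show "j = 0"
  proof (cases us)
    case Nil
    then show ?thesis using h by (auto simp: pat_21_3_k_def)
  next
    case (Cons u us')
    then have "b \<in> set (map (\<lambda>i. [i]) [3..<Suc k])" using h(1) by (simp add: pat_21_3_k_def)
    then have "length b = 1" by auto
    then show ?thesis using h by simp
  qed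
next
  assume "j = 0"
  then show "same_block (pat_21_3_k k) j" unfolding same_block_def pat_21_3_k_def
    by (intro exI[of _ "[]"] exI[of _ "[2, 1]"] exI[of _ "map (\<lambda>i. [i]) [3..<Suc k]"]) simp
qed

text \<open>It is enough that \<open>g\<close> ascends wherever \<open>w\<close> does: the letters
  of \<open>w\<close> are distinct, so trichotomy gives the converse. The right side lists
  generating ascents; those from the letter 1 to the tail follow by transitivity through the letter
  2.\<close>

lemma order_iso_213_iff:
  fixes g :: "nat \<Rightarrow> nat"
  assumes "k \<ge> 2"
  defines "w \<equiv> 2 # 1 # [3..<Suc k]"
  shows "(\<forall>i<k. \<forall>j<k. g i < g j \<longleftrightarrow> w ! i < w ! j) \<longleftrightarrow>
    g 1 < g 0 \<and> (\<forall>i. 2 \<le> i \<and> i < k \<longrightarrow> g 0 < g i) \<and>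
    (\<forall>i j. 2 \<le> i \<and> i < j \<and> j < k \<longrightarrow> g i < g j)" (is "?L \<longleftrightarrow> ?R")
proof -
  have w: "w ! 0 = 2" "w ! 1 = 1" "\<And>i. 2 \<le> i \<Longrightarrow> i < k \<Longrightarrow> w ! i = Suc i"
    by (auto simp: w_def nth_Cons split: nat.splits simp del: upt_Suc)
  show ?thesis
  proof
    assume l: ?L
    have l: "g i < g j" if "i < k" "j < k" "w ! i < w ! j" for i j using l that by blast
    show ?R using assms(1) by (auto intro!: l simp: w w[unfolded One_nat_def])
  next
    assume r: ?R
    have up: "g i < g j" if ij: "w ! i < w ! j" "i < k" "j < k" for i j
    proof -
      consider "i = 0" "j \<ge> 2" | "i = 1" "j = 0" | "i = 1" "j \<ge> 2" | "2 \<le> i" "i < j"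
      proof -
        have "i = 0 \<or> i = 1 \<or> 2 \<le> i" "j = 0 \<or> j = 1 \<or> 2 \<le> j" by auto
        then show ?thesis using that ij w(1,2) w(3)[of i] w(3)[of j] by auto
      qed
      then show ?thesis
      proof cases
        case 3
        then have "g 1 < g 0" "g 0 < g j" using r ij by auto
        then show ?thesis using 3 by simp
      qed (use r ij in auto)
    qed
    have inj: "i = j" if "w ! i = w ! j" "i < k" "j < k" for i j
    proof -
      have "i = 0 \<or> i = 1 \<or> 2 \<le> i" "j = 0 \<or> j = 1 \<or> 2 \<le> j" by auto
      then show ?thesis using that w(1,2) w(3)[of i] w(3)[of j] by auto
    qed
    show ?L
    proof (intro allI impI)
      fix i j assume ij: "i < k" "j < k"
      show "g i < g j \<longleftrightarrow> w ! i < w ! j"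
        using up[of i j] up[of j i] inj[of i j] ij by (cases "w ! i" "w ! j" rule: linorder_cases) auto
    qed
  qed
qed

text \<open>Positions count from 0: \<open>f 0\<close> and \<open>f 1\<close> carry the letters 2
  and 1, and \<open>f i\<close> for \<open>i >= 2\<close> carries the letter
  \<open>i + 1\<close>.\<close>

definition occurrence213 :: "nat \<Rightarrow> nat list \<Rightarrow> (nat \<Rightarrow> nat) \<Rightarrow> bool" where
  "occurrence213 k xs f \<longleftrightarrow> strict_mono_on {..<k} f \<and> (\<forall>i<k. f i < length xs) \<and>
     xs ! f 1 < xs ! f 0 \<and> (\<forall>i. 2 \<le> i \<and> i < k \<longrightarrow> xs ! f 0 < xs ! f i) \<and>
     (\<forall>i j. 2 \<le> i \<and> i < j \<and> j < k \<longrightarrow> xs ! f i < xs ! f j)"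

lemma gcontains_pat_2_1_3_k_iff:
  assumes "k \<ge> 2"
  shows "gcontains xs (pat_2_1_3_k k) \<longleftrightarrow> (\<exists>f. occurrence213 k xs f)"
proof -
  have l: "length (concat (pat_2_1_3_k k)) = k" using assms by (simp del: upt_Suc)
  have nb: "\<not> same_block (pat_2_1_3_k k) j" for j
    by (rule not_same_block_singletons) (auto simp: pat_2_1_3_k_def)
  show ?thesis unfolding gcontains_def occurrence213_def l
    unfolding concat_pat order_iso_213_iff[OF assms]
    by (simp add: nb)
qed

lemma gcontains_pat_21_3_k_iff:
  assumes "k \<ge> 2"
  shows "gcontains xs (pat_21_3_k k) \<longleftrightarrow> (\<exists>f. occurrence213 k xs f \<and> f 1 = Suc (f 0))"
proof -
  have l: "length (concat (pat_21_3_k k)) = k" using assms by (simp del: upt_Suc)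
  show ?thesis unfolding gcontains_def occurrence213_def l
    unfolding concat_pat order_iso_213_iff[OF assms]
    by (simp add: same_block_pat_21_3_k)
qed

text \<open>The tail \<open>cs\<close> collects the entries at pattern positions \<open>2\<close> to
  \<open>k - 1\<close>, hence its length \<open>k - 2\<close> and the index shift by two.\<close>

lemma gcontains_iff_contains213:
  assumes "k \<ge> 2"
  shows "gcontains xs (pat_2_1_3_k k) \<longleftrightarrow> contains213 (k - 2) xs"
  unfolding gcontains_pat_2_1_3_k_iff[OF assms]
proof
  assume "\<exists>f. occurrence213 k xs f"
  then obtain f where f: "occurrence213 k xs f" ..
  let ?cs = "map (\<lambda>i. xs ! f i) [2..<k]"
  have "[0..<k] = 0 # 1 # [2..<k]" using assms by (simp add: upt_conv_Cons numeral_2_eq_2)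
  then have ys: "xs ! f 0 # xs ! f 1 # ?cs = map (\<lambda>i. xs ! f i) [0..<k]" by simp
  have "subseq (map (\<lambda>i. xs ! f i) [0..<k]) xs"
    unfolding subseq_iff_strict_mono using f by (auto simp: occurrence213_def)
  then have "subseq (xs ! f 0 # xs ! f 1 # ?cs) xs" by (simp only: ys)
  moreover have "sorted_wrt (<) (xs ! f 0 # ?cs)"
    using f by (auto simp: occurrence213_def sorted_wrt_iff_nth_less nth_Cons split: nat.splits)
  moreover have "xs ! f 1 < xs ! f 0" "length ?cs = k - 2" using f by (auto simp: occurrence213_def)
  ultimately show "contains213 (k - 2) xs" unfolding contains213_def by blast
next
  assume "contains213 (k - 2) xs"
  then obtain a b cs where h: "subseq (a # b # cs) xs" "b < a" "sorted_wrt (<) (a # cs)"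
    "length cs = k - 2" unfolding contains213_def by blast
  have l: "length (a # b # cs) = k" using h(4) assms by simp
  from h(1) obtain f where f: "strict_mono_on {..<k} f"
    "\<And>i. i < k \<Longrightarrow> f i < length xs" "\<And>i. i < k \<Longrightarrow> (a # b # cs) ! i = xs ! f i"
    unfolding subseq_iff_strict_mono l by blast
  have x: "xs ! f 0 = a" "xs ! f 1 = b" using f(3)[of 0] f(3)[of 1] assms by auto
  have xc: "xs ! f i = cs ! (i - 2)" if "2 \<le> i" "i < k" for i
    using f(3)[OF that(2)] that(1) by (simp add: nth_Cons' numeral_2_eq_2)
  have "a < xs ! f i" if "2 \<le> i" "i < k" for i
  proof -
    have "cs ! (i - 2) \<in> set cs" using that h(4) by auto
    then show ?thesis using h(3) that by (simp add: xc)
  qed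
  moreover have "xs ! f i < xs ! f j" if "2 \<le> i" "i < j" "j < k" for i j
  proof -
    have "cs ! (i - 2) < cs ! (j - 2)"
      using h(3,4) that by (auto simp: sorted_wrt_iff_nth_less[of "(<)" cs])
    then show ?thesis using that by (simp add: xc)
  qed
  ultimately have "occurrence213 k xs f" using f h(2) by (simp add: occurrence213_def x x[unfolded One_nat_def])
  then show "\<exists>f. occurrence213 k xs f" by blast
qed

lemma gavoids_132_iff: "gavoids xs [[1], [3], [2]] \<longleftrightarrow> avoids132 xs"
proof -
  let ?w = "[1, 3, 2] :: nat list"
  have c: "concat [[1], [3], [2]] = ?w" "length ?w = 3" by simp_all
  have nb: "\<not> same_block [[1], [3], [2]] j" for j by (rule not_same_block_singletons) auto
  have lt3: "(\<forall>i<3. Q i) \<longleftrightarrow> Q 0 \<and> Q 1 \<and> Q 2" for Q :: "nat \<Rightarrow> bool"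
    by (auto simp: numeral_3_eq_3 numeral_2_eq_2 less_Suc_eq)
  have "gcontains xs [[1], [3], [2]] \<longleftrightarrow>
    (\<exists>i j l. i < j \<and> j < l \<and> l < length xs \<and> xs ! i < xs ! l \<and> xs ! l < xs ! j)"
  proof
    assume "gcontains xs [[1], [3], [2]]"
    then obtain f where f: "strict_mono_on {..<3} f" "\<forall>i<3. f i < length xs"
      "\<forall>i<3. \<forall>j<3. xs ! f i < xs ! f j \<longleftrightarrow> ?w ! i < ?w ! j"
      unfolding gcontains_def c by blast
    have "f 0 < f 1" "f 1 < f 2" using f(1) by (auto simp: strict_mono_on_def)
    moreover have "f 2 < length xs" using f(2) by simp
    moreover have "xs ! f 0 < xs ! f 2" "xs ! f 2 < xs ! f 1" using f(3) by (simp_all add: lt3)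
    ultimately show "\<exists>i j l. i < j \<and> j < l \<and> l < length xs \<and> xs ! i < xs ! l \<and> xs ! l < xs ! j"
      by blast
  next
    assume "\<exists>i j l. i < j \<and> j < l \<and> l < length xs \<and> xs ! i < xs ! l \<and> xs ! l < xs ! j"
    then obtain i j l where h: "i < j" "j < l" "l < length xs" "xs ! i < xs ! l" "xs ! l < xs ! j"
      by blast
    \<comment> \<open>Pattern positions 0, 1, 2 carry the letters 1, 3, 2, so the middle value sits
      at the last position \<open>l\<close>.\<close>
    define f where "f = (!) [i, j, l]"
    have "strict_mono_on {..<3} f"
      unfolding strict_mono_on_def f_def using h by (auto simp: numeral_3_eq_3 less_Suc_eq)
    moreover have "\<forall>i<3. f i < length xs" using h by (simp add: lt3 f_def)
    moreover have "\<forall>i<3. \<forall>j<3. xs ! f i < xs ! f j \<longleftrightarrow> ?w ! i < ?w ! j"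
      using h by (simp add: lt3 f_def)
    ultimately show "gcontains xs [[1], [3], [2]]"
      unfolding gcontains_def c using nb by blast
  qed
  then show ?thesis unfolding gavoids_def avoids132_iff_nth by blast
qed

section \<open>From a dashed 2-1 to an adjacent descent\<close>

text \<open>Let \<open>l\<close> be the last position before the letter \<open>1\<close> of an occurrence of 2-1-3-...-k
  carrying a value at least that of the letter \<open>2\<close>. The entry at \<open>l\<close> is followed by a descent, and
  it stays below the letter \<open>3\<close>, as otherwise the letters \<open>2\<close> and \<open>3\<close> would form a 1-3-2 with it.\<close>

lemma gcontains_21_iff_gcontains_2_1:
  assumes "k \<ge> 2" "distinct xs" "avoids132 xs"
  shows "gcontains xs (pat_21_3_k k) \<longleftrightarrow> gcontains xs (pat_2_1_3_k k)"
proof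
  assume "gcontains xs (pat_21_3_k k)"
  then show "gcontains xs (pat_2_1_3_k k)"
    unfolding gcontains_pat_21_3_k_iff[OF assms(1)] gcontains_pat_2_1_3_k_iff[OF assms(1)] by blast
next
  assume "gcontains xs (pat_2_1_3_k k)"
  then obtain f where f: "occurrence213 k xs f" unfolding gcontains_pat_2_1_3_k_iff[OF assms(1)] ..
  have mono: "f i < f j" if "i < j" "j < k" for i j
    using f that by (auto simp: occurrence213_def strict_mono_on_def)
  have len: "f i < length xs" if "i < k" for i using f that by (simp add: occurrence213_def)
  have o: "xs ! f 1 < xs ! f 0" "\<And>i. 2 \<le> i \<Longrightarrow> i < k \<Longrightarrow> xs ! f 0 < xs ! f i"
    "\<And>i j. 2 \<le> i \<Longrightarrow> i < j \<Longrightarrow> j < k \<Longrightarrow> xs ! f i < xs ! f j"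
    using f by (simp_all add: occurrence213_def)
  define S where "S = {l. f 0 \<le> l \<and> l < f 1 \<and> xs ! f 0 \<le> xs ! l}"
  have f01: "f 0 < f 1" using mono assms(1) by simp
  have S: "finite S" "f 0 \<in> S" using f01 by (auto simp: S_def)
  define l where "l = Max S"
  have l: "f 0 \<le> l" "l < f 1" "xs ! f 0 \<le> xs ! l"
    using Max_in[OF S(1)] S(2) unfolding l_def[symmetric] by (auto simp: S_def)
  \<comment> \<open>Either \<open>Suc l\<close> is the position of the letter 1, or it precedes that
    position and is outside \<open>S\<close> by maximality of \<open>l\<close>.\<close>
  have drop: "xs ! Suc l < xs ! f 0"
  proof (cases "Suc l = f 1")
    case False
    have "Suc l \<notin> S" using Max_ge[OF S(1), of "Suc l"] by (auto simp: l_def)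
    then show ?thesis using l False by (auto simp: S_def)
  qed (use o(1) in simp)
  have up: "xs ! l < xs ! f i" if i: "2 \<le> i" "i < k" for i
  proof (rule ccontr)
    assume n: "\<not> ?thesis"
    have li: "l < f i" using l(2) mono[of 1 i] i by simp
    have "xs ! l \<noteq> xs ! f i" using assms(2) li len[OF i(2)] by (simp add: nth_eq_iff_index_eq)
    then have g: "xs ! f i < xs ! l" using n by simp
    moreover have "xs ! f 0 < xs ! f i" using o(2) i by blast
    \<comment> \<open>Equality would place the letter 2 at \<open>l\<close>, yet that letter is
      below the entry at \<open>f i\<close>. So \<open>f 0\<close>, \<open>l\<close>,
      \<open>f i\<close> are distinct positions of a 1-3-2.\<close>
    moreover from this g have "f 0 < l" using l(1) by (cases "f 0 = l") auto
    ultimately show False using assms(3) li len[OF i(2)] unfolding avoids132_iff_nth by blast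
  qed
  \<comment> \<open>Only the letters 2 and 1 move; the tail stays to their right because
    \<open>Suc l\<close> is at most \<open>f 1\<close>.\<close>
  define g where "g = f(0 := l, 1 := Suc l)"
  have g: "g 0 = l" "g 1 = Suc l" "\<And>i. 2 \<le> i \<Longrightarrow> g i = f i" by (auto simp: g_def)
  have below: "Suc l < f i" if "2 \<le> i" "i < k" for i
    using mono[of 1 i] that l(2) by simp
  have "strict_mono_on {..<k} g"
  proof (rule strict_mono_onI)
    fix i j assume ij: "i \<in> {..<k}" "j \<in> {..<k}" "i < j"
    have "i = 0 \<or> i = 1 \<or> 2 \<le> i" "j = 1 \<or> 2 \<le> j" using ij by auto
    then show "g i < g j" using ij below[of j] mono[of i j] g by auto
  qed
  moreover have "g i < length xs" if "i < k" for i
  proof -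
    have "i = 0 \<or> i = 1 \<or> 2 \<le> i" by auto
    then show ?thesis using len[OF that] len[of 1] l(2) assms(1) g by auto
  qed
  ultimately have "occurrence213 k xs g"
    unfolding occurrence213_def using drop up o(3) l(3) g by auto
  then show "gcontains xs (pat_21_3_k k)"
    unfolding gcontains_pat_21_3_k_iff[OF assms(1)] using g(1,2) by auto
qed

section \<open>Assembling the counts\<close>

lemma D_count_2_1_3_k:
  assumes "k \<ge> 2"
  shows "D_count (pat_2_1_3_k k) n = card (avoiders (k - 2) n)"
  unfolding D_count_def avoiders_def dumont132_def permutations_of_set_def gavoids_132_iff
  unfolding gavoids_def gcontains_iff_contains213[OF assms]
  by (rule arg_cong[of _ _ card]) auto

lemma D_count_21_3_k:
  assumes "k \<ge> 2"
  shows "D_count (pat_21_3_k k) n = D_count (pat_2_1_3_k k) n"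
  unfolding D_count_def gavoids_132_iff
  by (rule arg_cong[of _ _ card])
     (auto simp: gavoids_def gcontains_21_iff_gcontains_2_1[OF assms] permutations_of_set_def)

theorem theorem2p13:
  fixes k :: nat
  assumes "k \<ge> 2"
  shows "D_gf (pat_21_3_k k) = D_gf (pat_2_1_3_k k) \<and>
         D_gf (pat_2_1_3_k k) = G (k - 1) + fps_X * G (k - 2)"
proof
  show "D_gf (pat_21_3_k k) = D_gf (pat_2_1_3_k k)"
    unfolding D_gf_def D_count_21_3_k[OF assms] ..
  have "Suc (k - 2) = k - 1" using assms by simp
  then show "D_gf (pat_2_1_3_k k) = G (k - 1) + fps_X * G (k - 2)"
    unfolding D_gf_def D_count_2_1_3_k[OF assms] avoiders_gf_total by simp
qed

end
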